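(* Let $c<d$ be real numbers and let $\rho$ be a probability density on $[c,d]$ with $\rho(x)>0$ for all $x\in[c,d]$. Let $x$ and $y$ be independent random variables, each with density $\rho$ on $[c,d]$. Let $p\in\mathbb{R}$ be the value of a pointer drawn independently of $x$ and $y$ from a distribution on $\mathbb{R}$ giving positive probability to every nonempty open set. Alice sees $x$ and $p$ but not $y$; she guesses that $x<y$ if $p>x$, and guesses that $x>y$ if $p<x$. Let $P(SG)=P(x<p,\ x<y)+P(x>p,\ x>y)$ be the probability of a successful guess given the pointer value $p$. Then: (1) If $p<c$ or $p>d$, then $P(SG)=\tfrac12$. (2) If $c<p<d$, then $P(SG)>\tfrac12$.
   Context: The outcomes $x$ and $y$ are the results of Experiments A and B, which are two independent trials of the same experiment. The pointer is an auxiliary real number used to make the guess; in (1) and (2) the probabilities are computed for the given value $p$ of the pointer, i.e. over the randomness of $x$ and $y$ only. *)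

theory Defs
  imports "HOL-Probability.Probability"
begin

text \<open>Only the values of \<open>\<rho>\<close> on \<open>[c, d]\<close> matter; outside this interval \<open>\<rho>\<close> is arbitrary.\<close>

definition prob_density_on :: "real \<Rightarrow> real \<Rightarrow> (real \<Rightarrow> real) \<Rightarrow> bool" where
  "prob_density_on c d \<rho> \<longleftrightarrow>
     (\<forall>t\<in>{c..d}. 0 \<le> \<rho> t) \<and>
     set_integrable lborel {c..d} \<rho> \<and>
     (LINT t:{c..d}|lborel. \<rho> t) = 1"

definition has_density_on ::
  "'a measure \<Rightarrow> ('a \<Rightarrow> real) \<Rightarrow> real \<Rightarrow> real \<Rightarrow> (real \<Rightarrow> real) \<Rightarrow> bool" where
  "has_density_on M X c d \<rho> \<longleftrightarrow>
     distributed M lborel X (\<lambda>t. ennreal (indicator {c..d} t * \<rho> t))"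

definition full_support :: "real measure \<Rightarrow> bool" where
  "full_support D \<longleftrightarrow> (\<forall>U. open U \<longrightarrow> U \<noteq> {} \<longrightarrow> measure D U > 0)"

text \<open>The pointer value \<open>p\<close> is a fixed number here: the probability is taken over \<open>X\<close> and \<open>Y\<close> only.\<close>

definition prob_SG :: "'a measure \<Rightarrow> ('a \<Rightarrow> real) \<Rightarrow> ('a \<Rightarrow> real) \<Rightarrow> real \<Rightarrow> real" where
  "prob_SG M X Y p =
     measure M {\<omega> \<in> space M. X \<omega> < p \<and> X \<omega> < Y \<omega>} +
     measure M {\<omega> \<in> space M. X \<omega> > p \<and> X \<omega> > Y \<omega>}"

end

theory Submission
  imports Defs
begin

text \<open>
  Exchanging \<open>X\<close> and \<open>Y\<close> in the second summand turns the success probability into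
  \<open>P(X < Y, X < p) + P(X < Y, p < Y)\<close>. On the event \<open>X < Y\<close> at least one of \<open>X < p\<close>, \<open>p < Y\<close> holds,
  so inclusion-exclusion gives \<open>P(SG) = P(X < Y) + P(X < p < Y) = 1/2 + P(X < p) P(p < Y)\<close>.
  The product vanishes outside \<open>[c, d]\<close> and is positive on its interior.
\<close>

text \<open>Independence says that the joint law of the pair is the product of the marginal laws.
  This moves every event about the pair into the plane, where product measures and sections can be
  used.\<close>

lemma (in prob_space) indep_var_prob_pair:
  assumes "indep_var borel X borel Y" and "A \<in> sets (borel \<Otimes>\<^sub>M borel)"
  shows "prob {\<omega> \<in> space M. (X \<omega>, Y \<omega>) \<in> A} = measure (distr M borel X \<Otimes>\<^sub>M distr M borel Y) A"
proof -
  have [measurable]: "random_variable borel X" "random_variable borel Y"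
    using assms(1) by (auto simp: indep_var_distribution_eq)
  have "measure (distr M borel X \<Otimes>\<^sub>M distr M borel Y) A
      = measure (distr M (borel \<Otimes>\<^sub>M borel) (\<lambda>\<omega>. (X \<omega>, Y \<omega>))) A"
    using assms(1) by (simp add: indep_var_distribution_eq)
  also have "\<dots> = prob ((\<lambda>\<omega>. (X \<omega>, Y \<omega>)) -` A \<inter> space M)"
    using assms(2) by (subst measure_distr) auto
  also have "(\<lambda>\<omega>. (X \<omega>, Y \<omega>)) -` A \<inter> space M = {\<omega> \<in> space M. (X \<omega>, Y \<omega>) \<in> A}"
    by auto
  finally show ?thesis ..
qed

lemma (in prob_space) indep_var_swap:
  assumes "indep_var S X T Y"
  shows "indep_var T Y S X"
proof -
  have "indep_set B A" if "indep_set A B" for A B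
  proof (rule indep_setI)
    show "B \<subseteq> events" "A \<subseteq> events"
      by (rule indep_setD_ev2[OF that], rule indep_setD_ev1[OF that])
    show "prob (b \<inter> a) = prob b * prob a" if "b \<in> B" "a \<in> A" for a b
      using indep_setD[OF \<open>indep_set A B\<close> that(2,1)]
      by (subst Int_commute, subst mult.commute)
  qed
  then show ?thesis
    using assms by (simp add: indep_var_eq)
qed

text \<open>With equal marginals, both orderings of the pair have the same product law.\<close>

lemma (in prob_space) iid_exchange:
  assumes "indep_var borel X borel Y" and "distr M borel X = distr M borel Y"
    and "A \<in> sets (borel \<Otimes>\<^sub>M borel)"
  shows "prob {\<omega> \<in> space M. (Y \<omega>, X \<omega>) \<in> A} = prob {\<omega> \<in> space M. (X \<omega>, Y \<omega>) \<in> A}"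
  using indep_var_prob_pair[OF assms(1,3)] indep_var_prob_pair[OF indep_var_swap[OF assms(1)] assms(3)]
    assms(2) by simp

text \<open>Each vertical section of the diagonal is a single point, which is null for the law of
  \<open>Y\<close>. Integrating the sections makes the diagonal null for the product law, whatever
  the law of \<open>X\<close> is.\<close>

lemma (in prob_space) indep_var_prob_eq_0:
  fixes X Y :: "'a \<Rightarrow> real"
  assumes "indep_var borel X borel Y" and "\<And>t. measure (distr M borel Y) {t} = 0"
  shows "prob {\<omega> \<in> space M. X \<omega> = Y \<omega>} = 0"
proof -
  have [measurable]: "random_variable borel X" "random_variable borel Y"
    using assms(1) by (auto simp: indep_var_distribution_eq)
  interpret Y: prob_space "distr M borel Y" by (rule prob_space_distr) simp
  define D where "D = {z :: real \<times> real. fst z = snd z}"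
  \<comment> \<open>The comprehension over \<open>space\<close> is a form that
    \<open>measurable\<close> can prove; the product space is then simplified to the whole
    plane.\<close>
  have "{z \<in> space (borel \<Otimes>\<^sub>M borel). fst z = snd z} \<in> sets (borel \<Otimes>\<^sub>M (borel :: real measure))"
    by measurable
  then have D: "D \<in> sets (borel \<Otimes>\<^sub>M borel)"
    by (simp add: D_def space_pair_measure)
  have "Pair x -` D = {x}" for x
    by (auto simp: D_def)
  then have "emeasure (distr M borel X \<Otimes>\<^sub>M distr M borel Y) D = 0"
    using D assms(2) by (subst Y.emeasure_pair_measure_alt) (auto simp: Y.emeasure_eq_measure)
  then show ?thesis
    using indep_var_prob_pair[OF assms(1) D] by (simp add: measure_def D_def)
qed

text \<open>The two strict orders are equally likely by exchange, and ties have probability zero, so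
  each strict order takes half of the total mass.\<close>

lemma (in prob_space) iid_prob_less:
  fixes X Y :: "'a \<Rightarrow> real"
  assumes "indep_var borel X borel Y" and "distr M borel X = distr M borel Y"
    and "\<And>t. measure (distr M borel Y) {t} = 0"
  shows "prob {\<omega> \<in> space M. X \<omega> < Y \<omega>} = 1 / 2"
proof -
  have [measurable]: "random_variable borel X" "random_variable borel Y"
    using assms(1) by (auto simp: indep_var_distribution_eq)
  have "{z \<in> space (borel \<Otimes>\<^sub>M borel). fst z < snd z} \<in> sets (borel \<Otimes>\<^sub>M (borel :: real measure))"
    by measurable
  from iid_exchange[OF assms(1,2) this]
  have "prob {\<omega> \<in> space M. Y \<omega> < X \<omega>} = prob {\<omega> \<in> space M. X \<omega> < Y \<omega>}"
    by (simp add: space_pair_measure)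
  moreover have "1 = prob ({\<omega> \<in> space M. X \<omega> < Y \<omega>} \<union> {\<omega> \<in> space M. Y \<omega> < X \<omega>} \<union> {\<omega> \<in> space M. X \<omega> = Y \<omega>})"
    by (subst prob_space[symmetric], rule arg_cong[where f = prob]) auto
  moreover have "\<dots> = prob {\<omega> \<in> space M. X \<omega> < Y \<omega>} + prob {\<omega> \<in> space M. Y \<omega> < X \<omega>}
      + prob {\<omega> \<in> space M. X \<omega> = Y \<omega>}"
    by (subst finite_measure_Union; (subst finite_measure_Union)?) auto
  ultimately show ?thesis
    using indep_var_prob_eq_0[OF assms(1,3)] by simp
qed

lemma (in prob_space) prob_SG_iid:
  assumes "indep_var borel X borel Y" and "distr M borel X = distr M borel Y"
    and "\<And>t. measure (distr M borel Y) {t} = 0"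
  shows "prob_SG M X Y p
    = 1 / 2 + measure (distr M borel X) {..<p} * measure (distr M borel X) {p<..}"
proof -
  have [measurable]: "random_variable borel X" "random_variable borel Y"
    using assms(1) by (auto simp: indep_var_distribution_eq)
  let ?A = "{\<omega> \<in> space M. X \<omega> < p \<and> X \<omega> < Y \<omega>}"
  let ?B = "{\<omega> \<in> space M. p < Y \<omega> \<and> X \<omega> < Y \<omega>}"
  \<comment> \<open>This set, hit by \<open>(Y, X)\<close>, is the second summand of
    \<open>prob_SG\<close>; hit by \<open>(X, Y)\<close>, it is \<open>?B\<close>.\<close>
  have "{z \<in> space (borel \<Otimes>\<^sub>M borel). p < snd z \<and> fst z < snd z} \<in> sets (borel \<Otimes>\<^sub>M (borel :: real measure))"
    by measurable
  from iid_exchange[OF assms(1,2) this]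
  have "prob_SG M X Y p = prob ?A + prob ?B"
    by (simp add: prob_SG_def space_pair_measure)
  also have "\<dots> = prob (?A \<union> ?B) + prob (?A \<inter> ?B)"
    by (subst measure_Un3) (auto simp: fmeasurable_eq_sets)
  also have "?A \<union> ?B = {\<omega> \<in> space M. X \<omega> < Y \<omega>}"
    by auto
  also have "?A \<inter> ?B = {\<omega> \<in> space M. (X \<omega>, Y \<omega>) \<in> {..<p} \<times> {p<..}}"
    by auto
  also have "prob \<dots> = measure (distr M borel X) {..<p} * measure (distr M borel Y) {p<..}"
  proof -
    interpret Y: prob_space "distr M borel Y" by (rule prob_space_distr) simp
    show ?thesis
      by (subst indep_var_prob_pair[OF assms(1)])
        (auto simp: measure_def Y.emeasure_pair_measure_Times enn2real_mult)
  qed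
  finally show ?thesis
    using iid_prob_less[OF assms] assms(2) by simp
qed

lemma has_density_on_emeasure:
  assumes "has_density_on M X c d \<rho>" and "A \<in> sets borel"
  shows "emeasure (distr M borel X) A
    = (\<integral>\<^sup>+t. ennreal (indicator {c..d} t * \<rho> t) * indicator A t \<partial>lborel)"
proof -
  \<comment> \<open>\<open>distributed\<close> is stated with target \<open>lborel\<close>, which
    has the same measurable sets as \<open>borel\<close>.\<close>
  have "distr M borel X = distr M lborel X"
    by (rule distr_cong) auto
  then show ?thesis
    using assms by (simp add: has_density_on_def distributed_def emeasure_density)
qed

text \<open>The integrand vanishes off \<open>A \<inter> {c..d}\<close>, hence almost everywhere.
  This serves both for single points and for half-lines that miss the interval.\<close>

lemma has_density_on_null:
  assumes "has_density_on M X c d \<rho>" and "A \<in> sets borel" and "emeasure lborel (A \<inter> {c..d}) = 0"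
  shows "measure (distr M borel X) A = 0"
proof -
  have "AE t in lborel. t \<notin> A \<inter> {c..d}"
    using assms(2,3) by (intro AE_not_in) (auto simp: null_sets_def)
  then have "AE t in lborel. ennreal (indicator {c..d} t * \<rho> t) * indicator A t = 0"
    by (rule AE_mp) (auto split: split_indicator)
  then have "emeasure (distr M borel X) A = 0"
    using has_density_on_emeasure[OF assms(1,2)]
    by (simp add: nn_integral_cong_AE[where v = "\<lambda>_. 0"])
  then show ?thesis
    by (simp add: measure_def)
qed

text \<open>A nonnegative integrand with integral zero vanishes almost everywhere; since \<rho> is
  positive on the interval, this would make \<open>A \<inter> {c..d}\<close> a Lebesgue null
  set.\<close>

lemma (in prob_space) has_density_on_pos:
  assumes "has_density_on M X c d \<rho>" and "A \<in> sets borel" and "emeasure lborel (A \<inter> {c..d}) > 0"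
    and "\<And>t. t \<in> {c..d} \<Longrightarrow> \<rho> t > 0"
  shows "measure (distr M borel X) A > 0"
proof (rule ccontr)
  have X: "random_variable borel X"
    and f: "(\<lambda>t. ennreal (indicator {c..d} t * \<rho> t)) \<in> borel_measurable lborel"
    using assms(1) by (auto simp: has_density_on_def distributed_def)
  interpret X: prob_space "distr M borel X" by (rule prob_space_distr) (rule X)
  assume "\<not> ?thesis"
  then have "emeasure (distr M borel X) A = 0"
    by (simp add: X.emeasure_eq_measure order.antisym not_less)
  then have "AE t in lborel. ennreal (indicator {c..d} t * \<rho> t) * indicator A t = 0"
    using f assms(2) by (simp add: has_density_on_emeasure[OF assms(1,2)] nn_integral_0_iff_AE)
  then have "AE t in lborel. t \<notin> A \<inter> {c..d}"
    by (rule AE_mp) (use assms(4) in \<open>force split: split_indicator_asm intro!: AE_I2\<close>)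
  moreover have "A \<inter> {c..d} \<in> sets lborel"
    using assms(2) by simp
  ultimately have "emeasure lborel (A \<inter> {c..d}) = 0"
    using AE_iff_null_sets[of "A \<inter> {c..d}" lborel] by (auto simp only: null_setsD1)
  then show False
    using assms(3) by simp
qed

theorem theorem2:
  fixes M :: "'a measure"
    and X Y Z :: "'a \<Rightarrow> real"
    and \<rho> :: "real \<Rightarrow> real"
    and c d p :: real
  assumes "c < d"
    and "prob_density_on c d \<rho>"
    and "\<And>t. t \<in> {c..d} \<Longrightarrow> \<rho> t > 0"
    and "prob_space M"
    and "has_density_on M X c d \<rho>"
    and "has_density_on M Y c d \<rho>"
    and "prob_space.indep_vars M (\<lambda>_. borel) (\<lambda>i. [X, Y, Z] ! i) {..<3::nat}"
    and "full_support (distr M borel Z)"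
  shows "(p < c \<or> p > d \<longrightarrow> prob_SG M X Y p = 1 / 2) \<and>
         (c < p \<and> p < d \<longrightarrow> prob_SG M X Y p > 1 / 2)"
proof -
  interpret prob_space M by fact
  let ?N = "distr M borel X"
  \<comment> \<open>Independence of the triple passes to the disjoint index blocks
    \<open>{0}\<close> and \<open>{1}\<close>; evaluating the restricted families at their only
    index recovers \<open>X\<close> and \<open>Y\<close>.\<close>
  have "indep_var borel ((\<lambda>f. f 0) \<circ> (\<lambda>\<omega>. restrict (\<lambda>i. ([X, Y, Z] ! i) \<omega>) {0::nat}))
      borel ((\<lambda>f. f 1) \<circ> (\<lambda>\<omega>. restrict (\<lambda>i. ([X, Y, Z] ! i) \<omega>) {1::nat}))"
    by (rule indep_var_compose[OF indep_var_restrict[OF assms(7)]])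
      (simp_all add: measurable_component_singleton)
  then have indep: "indep_var borel X borel Y"
    by (simp add: comp_def)
  \<comment> \<open>The density formula for the law depends only on \<rho>, \<open>c\<close> and
    \<open>d\<close>, not on the random variable.\<close>
  have same: "?N = distr M borel Y"
    by (rule measure_eqI)
      (simp_all add: has_density_on_emeasure[OF assms(5)] has_density_on_emeasure[OF assms(6)])
  have "measure (distr M borel Y) {t} = 0" for t
  proof (rule has_density_on_null[OF assms(6)])
    have "emeasure lborel ({t} \<inter> {c..d}) \<le> emeasure lborel {t}"
      by (rule emeasure_mono) auto
    then show "emeasure lborel ({t} \<inter> {c..d}) = 0"
      by simp
  qed simp
  note SG = prob_SG_iid[OF indep same this, of p]
  show ?thesis
  proof (intro conjI impI)
    assume "p < c \<or> p > d"
    then show "prob_SG M X Y p = 1 / 2"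
    proof
      assume "p < c"
      then have "{..<p} \<inter> {c..d} = {}"
        by auto
      then have "measure ?N {..<p} = 0"
        by (intro has_density_on_null[OF assms(5)]) simp_all
      then show ?thesis
        by (simp add: SG)
    next
      assume "p > d"
      then have "{p<..} \<inter> {c..d} = {}"
        by auto
      then have "measure ?N {p<..} = 0"
        by (intro has_density_on_null[OF assms(5)]) simp_all
      then show ?thesis
        by (simp add: SG)
    qed
  next
    assume p: "c < p \<and> p < d"
    \<comment> \<open>The two half-lines cut out intervals of lengths \<open>p - c\<close> and
      \<open>d - p\<close>, both positive, so both factors in \<open>SG\<close> are
      positive.\<close>
    then have "{..<p} \<inter> {c..d} = {c..<p}" and "{p<..} \<inter> {c..d} = {p<..d}"
      by auto
    then have "emeasure lborel ({..<p} \<inter> {c..d}) > 0" and "emeasure lborel ({p<..} \<inter> {c..d}) > 0"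
      using p by simp_all
    then have "measure ?N {..<p} > 0" and "measure ?N {p<..} > 0"
      using has_density_on_pos[OF assms(5) _ _ assms(3)] by simp_all
    then have "measure ?N {..<p} * measure ?N {p<..} > 0"
      by (rule mult_pos_pos)
    then show "prob_SG M X Y p > 1 / 2"
      by (simp add: SG)
  qed
qed

end
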